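(* Let $F$ be a field of characteristic $2$ and let $U$ be an orthogonal $4n\times 4n$ matrix over $F$, i.e. $UU^{T}=I_{4n}$, with block form $U=\begin{pmatrix} A\\ B\\ C\\ D\end{pmatrix}$, where $A,B,C,D$ are blocks of size $n\times 4n$. Define $$G[z]=\begin{pmatrix} A\\ B\\ C\end{pmatrix}+\begin{pmatrix} B\\ C\\ D\end{pmatrix}z .$$ Then $G[z]$ is a noncatastrophic generator matrix of a convolutional $(4n,3n,3n;1)$ code, and this code is dual-containing.
   Context: A convolutional code over $F$ with parameters $(N,k,\delta;\mu)$ is the $F[z]$-submodule $\{u(z)G[z]:u(z)\in F[z]^k\}$ of $F[z]^N$ for a generator matrix $G[z]\in F[z]^{k\times N}$ of rank $k$, where $\delta$ is the sum, and $\mu$ the maximum, of the row degrees of $G[z]$ (the row degree is the maximal degree of an entry in the row). $G[z]$ is noncatastrophic if there is a polynomial $N\times k$ matrix $K[z]$ of rank $k$ with $G[z]K[z]=I_k$. A control matrix of a code $\mathcal C$ of rank $k$ is an $N\times (N-k)$ polynomial matrix $H[z]$ with $\mathcal C=\{v\in F[z]^N: vH[z]=0\}$; control matrices are considered up to multiplication by a power $z^i$. The code $\mathcal C$ is dual-containing if the code generated by $H[z^{-1}]^{T}$ (multiplied by a suitable power of $z$ so as to be a polynomial matrix), where $H[z]$ is a control matrix of $\mathcal C$, is contained in $\mathcal C$. *)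

theory Defs
  imports
    "Jordan_Normal_Form.DL_Rank"
    "HOL-Computational_Algebra.Polynomial_Factorial"
begin

text \<open>Row vectors are represented by plain vectors, so \<open>u G\<close> is written \<open>G\<^sup>T u\<close>.\<close>

definition generated_code :: "'a::field poly mat \<Rightarrow> 'a poly vec set" where
  "generated_code G = {transpose_mat G *\<^sub>v u | u. u \<in> carrier_vec (dim_row G)}"

text \<open>The rank of a polynomial matrix is its rank over the field of rational functions.\<close>

definition poly_rank :: "'a::field poly mat \<Rightarrow> nat" where
  "poly_rank M = vec_space.rank (dim_row M) (map_mat to_fract M)"

text \<open>A zero row has row degree 0, following the convention of \<^const>\<open>degree\<close>.\<close>

definition row_degree :: "'a::field poly mat \<Rightarrow> nat \<Rightarrow> nat" where
  "row_degree G i = Max {degree (G $$ (i, j)) | j. j < dim_col G}"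

definition generator_matrix ::
    "nat \<Rightarrow> nat \<Rightarrow> nat \<Rightarrow> nat \<Rightarrow> 'a::field poly mat \<Rightarrow> bool" where
  "generator_matrix N k \<delta> \<mu> G \<longleftrightarrow>
     G \<in> carrier_mat k N \<and> poly_rank G = k \<and>
     \<delta> = (\<Sum>i<k. row_degree G i) \<and> \<mu> = Max (row_degree G ` {..<k})"

definition convolutional_code ::
    "nat \<Rightarrow> nat \<Rightarrow> nat \<Rightarrow> nat \<Rightarrow> 'a::field poly vec set \<Rightarrow> bool" where
  "convolutional_code N k \<delta> \<mu> C \<longleftrightarrow> (\<exists>G. generator_matrix N k \<delta> \<mu> G \<and> C = generated_code G)"

definition noncatastrophic :: "'a::field poly mat \<Rightarrow> bool" where
  "noncatastrophic G \<longleftrightarrow>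
     (\<exists>K \<in> carrier_mat (dim_col G) (dim_row G).
        poly_rank K = dim_row G \<and> G * K = 1\<^sub>m (dim_row G))"

definition control_matrix ::
    "nat \<Rightarrow> nat \<Rightarrow> 'a::field poly vec set \<Rightarrow> 'a poly mat \<Rightarrow> bool" where
  "control_matrix N k C H \<longleftrightarrow>
     H \<in> carrier_mat N (N - k) \<and>
     C = {v \<in> carrier_vec N. transpose_mat H *\<^sub>v v = 0\<^sub>v (N - k)}"

text \<open>The indeterminate \<open>z\<close> and the substitution \<open>p(z\<^sup>-\<^sup>1)\<close>, as rational functions.\<close>

definition fract_z :: "'a::field poly fract" where
  "fract_z = to_fract [:0, 1:]"

definition subst_inverse :: "'a::field poly \<Rightarrow> 'a poly fract" where
  "subst_inverse p = poly (map_poly (\<lambda>a. to_fract [:a:]) p) (inverse fract_z)"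

text \<open>\<open>R\<close> is a polynomial matrix equal to \<open>z\<^sup>i H[z\<^sup>-\<^sup>1]\<^sup>T\<close> for some integer \<open>i\<close>.\<close>

definition reciprocal_transpose :: "'a::field poly mat \<Rightarrow> 'a poly mat \<Rightarrow> bool" where
  "reciprocal_transpose H R \<longleftrightarrow>
     (\<exists>i::int. map_mat to_fract R =
        (fract_z powi i) \<cdot>\<^sub>m transpose_mat (map_mat subst_inverse H))"

text \<open>
  The first conjunct excludes codes without a control matrix.  The second one ranges over all
  control matrices and all admissible powers of \<open>z\<close>.  The choice does not matter: a code that is
  the kernel of a control matrix contains \<open>v\<close> whenever it contains \<open>p v\<close> for some nonzero
  polynomial \<open>p\<close>, and any two control matrices have the same column span over the rational
  functions.
\<close>

definition dual_containing :: "nat \<Rightarrow> nat \<Rightarrow> 'a::field poly vec set \<Rightarrow> bool" where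
  "dual_containing N k C \<longleftrightarrow>
     (\<exists>H. control_matrix N k C H) \<and>
     (\<forall>H R. control_matrix N k C H \<and> reciprocal_transpose H R \<longrightarrow> generated_code R \<subseteq> C)"

end

theory Submission
  imports Defs
begin

text \<open>
  Write \<open>G = S U\<close> with \<open>S = (I | 0) + z (0 | I)\<close>.  Since \<open>U\<close> is constant and orthogonal, everything can
  be transported from \<open>G\<close> to \<open>S\<close>.  A right inverse of \<open>S\<close> comes from the inverse of its unipotent
  part, and the row module of \<open>S\<close> is the kernel of the column \<open>(-z\<^sup>3, z\<^sup>2, -z, 1)\<close> of \<open>n \<times> n\<close> blocks.
  If \<open>H\<close> is any control matrix, then \<open>S (U H) = 0\<close>, so the \<open>n\<close>-row blocks of \<open>U H\<close> form a geometric
  progression with ratio \<open>-z\<^sup>-\<^sup>1\<close>; replacing \<open>z\<close> by its inverse turns the ratio into \<open>-z\<close>, and four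
  equal terms cancel in characteristic 2.
\<close>

section \<open>Ranks from one-sided inverses\<close>

lemma mult_mat_vec_unit_vec:
  fixes M :: "'b::semiring_1 mat"
  assumes "M \<in> carrier_mat m k" "j < k"
  shows "M *\<^sub>v unit_vec k j = col M j"
  using assms by (intro eq_vecI) (auto simp: scalar_prod_right_unit)

text \<open>\<open>X * Y = 1\<close> makes \<open>X\<close> surjective, so its columns span, and
  \<open>Y\<close> injective, so its columns are independent.\<close>

lemma rank_of_one_sided_inverse:
  fixes X Y :: "'b::field mat"
  assumes X: "X \<in> carrier_mat k m" and Y: "Y \<in> carrier_mat m k"
    and XY: "X * Y = 1\<^sub>m k"
  shows "vec_space.rank k X = k" "vec_space.rank m Y = k"
proof -
  interpret k: vec_space "TYPE('b)" k .
  interpret m: vec_space "TYPE('b)" m .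
  have "v \<in> k.col_space X" if v: "v \<in> carrier_vec k" for v
  proof -
    have "X *\<^sub>v (Y *\<^sub>v v) = v"
      using assoc_mult_mat_vec[OF X Y v] v XY by simp
    then show ?thesis
      using X Y v by (subst k.col_space_eq[OF X]) (auto intro!: bexI[of _ "Y *\<^sub>v v"])
  qed
  moreover have "k.col_space X \<subseteq> carrier_vec k"
    using k.col_space_eq[OF X] X by auto
  ultimately have "k.span (set (cols X)) = carrier_vec k"
    unfolding k.col_space_def by blast
  then show "vec_space.rank k X = k"
    unfolding k.rank_def using k.dim_is_n by (simp add: module_vec_def)

  have inj: "v = 0\<^sub>v k" if v: "v \<in> carrier_vec k" and "Y *\<^sub>v v = 0\<^sub>v m" for v
  proof -
    have "X *\<^sub>v 0\<^sub>v m = 0\<^sub>v k" using X by (intro eq_vecI) auto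
    then show ?thesis using assoc_mult_mat_vec[OF X Y v] that XY by simp
  qed
  \<comment> \<open>Independence concerns the set of columns, so repetitions must be excluded first:
    \<open>X\<close> recovers the unit vectors from the columns of \<open>Y\<close>.\<close>
  have dist: "distinct (cols Y)"
  proof -
    have "i = j" if ij: "i < k" "j < k" and eq: "col Y i = col Y j" for i j
    proof -
      have "Y *\<^sub>v (unit_vec k i) = Y *\<^sub>v (unit_vec k j)"
        using ij eq by (simp add: mult_mat_vec_unit_vec[OF Y])
      then have "(X * Y) *\<^sub>v (unit_vec k i) = (X * Y) *\<^sub>v (unit_vec k j)"
        by (simp add: assoc_mult_mat_vec[OF X Y])
      then have "unit_vec k i = (unit_vec k j :: 'b vec)" by (simp add: XY)
      then show ?thesis using ij by (metis index_unit_vec(1) zero_neq_one)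
    qed
    then show ?thesis using Y by (auto simp: distinct_conv_nth)
  qed
  have "m.lin_indpt (set (cols Y))"
    using m.lin_depE[OF Y _ dist] inj by blast
  then show "vec_space.rank m Y = k"
    using m.lin_indpt_full_rank[OF Y dist] by simp
qed

lemma map_mat_to_fract_mult:
  fixes X Y :: "'a::idom mat"
  assumes X: "X \<in> carrier_mat k m" and Y: "Y \<in> carrier_mat m l"
  shows "map_mat to_fract (X * Y) = map_mat to_fract X * map_mat to_fract Y"
proof -
  interpret semiring_hom "to_fract :: 'a \<Rightarrow> 'a fract"
    by unfold_locales auto
  show ?thesis by (rule mat_hom_mult[OF X Y])
qed

text \<open>The identity persists over the rational functions, where \<open>poly_rank\<close> is
  measured. Applied to \<open>G * K = 1\<close>, it settles the ranks of the generator matrix and of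
  its right inverse together.\<close>

lemma poly_rank_of_one_sided_inverse:
  fixes X Y :: "'a::field poly mat"
  assumes X: "X \<in> carrier_mat k m" and Y: "Y \<in> carrier_mat m k" and XY: "X * Y = 1\<^sub>m k"
  shows "poly_rank X = k" "poly_rank Y = k"
proof -
  have "map_mat to_fract (1\<^sub>m k) = (1\<^sub>m k :: 'a poly fract mat)"
    by (auto intro!: eq_matI)
  then have "map_mat to_fract X * map_mat to_fract Y = 1\<^sub>m k"
    using map_mat_to_fract_mult[OF X Y] XY by simp
  then show "poly_rank X = k" "poly_rank Y = k"
    using rank_of_one_sided_inverse[of "map_mat to_fract X" k m "map_mat to_fract Y"] X Y
    by (auto simp: poly_rank_def)
qed

section \<open>The substitution of the inverse of \<open>z\<close>\<close>

lemma subst_inverse_0 [simp]: "subst_inverse 0 = 0"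
  by (simp add: subst_inverse_def)

lemma subst_inverse_pCons [simp]:
  "subst_inverse (pCons a p) = to_fract [:a:] + inverse fract_z * subst_inverse p"
  by (simp add: subst_inverse_def map_poly_pCons)

lemma subst_inverse_add: "subst_inverse (p + q) = subst_inverse p + subst_inverse q"
proof (induction p q rule: poly_induct2)
  case (pCons a p b q)
  have "to_fract [:a + b:] = to_fract [:a:] + to_fract [:b:]"
    by (simp flip: to_fract_add)
  with pCons show ?case by (simp add: algebra_simps)
qed simp

lemma subst_inverse_sum: "subst_inverse (sum f I) = (\<Sum>i\<in>I. subst_inverse (f i))"
  by (induction I rule: infinite_finite_induct) (auto simp: subst_inverse_add)

text \<open>Constants are fixed by the substitution, so it commutes with multiplication by the
  constant matrix \<open>P\<close>.\<close>

lemma subst_inverse_const_mult: "subst_inverse ([:a:] * p) = to_fract [:a:] * subst_inverse p"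
proof (induction p)
  case (pCons b p)
  have "to_fract [:a * b:] = to_fract [:a:] * to_fract [:b:]"
    by (simp flip: to_fract_mult)
  with pCons show ?case by (simp add: algebra_simps)
qed simp

section \<open>The banded matrix \<open>S\<close>, its right inverse and its row module\<close>

definition shift_mat :: "nat \<Rightarrow> 'a::field poly mat" where
  "shift_mat n = mat (3 * n) (4 * n)
     (\<lambda>(i, j). (if j = i then 1 else 0) + (if j = i + n then [:0, 1:] else 0))"

text \<open>The first \<open>3 * n\<close> columns of \<open>S\<close> form \<open>I + z N\<close>
  with \<open>N\<close> the block shift, and \<open>N^3 = 0\<close>. The top \<open>3 * n\<close>
  rows here are the finite Neumann series \<open>I - z N + z^2 N^2\<close>; the last
  \<open>n\<close> rows vanish.\<close>

definition shift_right_inverse :: "nat \<Rightarrow> 'a::field poly mat" where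
  "shift_right_inverse n = mat (4 * n) (3 * n)
     (\<lambda>(i, j). (if j = i then 1 else 0) - (if j = i + n then [:0, 1:] else 0)
        + (if j = i + 2 * n then [:0, 1:]\<^sup>2 else 0))"

definition shift_control :: "nat \<Rightarrow> 'a::field poly mat" where
  "shift_control n = mat (4 * n) n
     (\<lambda>(i, j). (if i = j + 3 * n then 1 else 0) - (if i = j + 2 * n then [:0, 1:] else 0)
        + (if i = j + n then [:0, 1:]\<^sup>2 else 0) - (if i = j then [:0, 1:] ^ 3 else 0))"

lemma shift_mat_carrier [simp]: "shift_mat n \<in> carrier_mat (3 * n) (4 * n)"
  and shift_right_inverse_carrier [simp]: "shift_right_inverse n \<in> carrier_mat (4 * n) (3 * n)"
  and shift_control_carrier [simp]: "shift_control n \<in> carrier_mat (4 * n) n"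
  by (auto simp: shift_mat_def shift_right_inverse_def shift_control_def)

lemma shift_mat_mult:
  fixes M :: "'a::field poly mat"
  assumes n: "n > 0" and M: "M \<in> carrier_mat (4 * n) m" and i: "i < 3 * n" and j: "j < m"
  shows "(shift_mat n * M) $$ (i, j) = M $$ (i, j) + [:0, 1:] * M $$ (i + n, j)"
proof -
  have "(shift_mat n * M) $$ (i, j) =
      (\<Sum>l<4 * n. ((if l = i then 1 else 0) + (if l = i + n then [:0, 1:] else 0)) * M $$ (l, j))"
    using assms by (simp add: shift_mat_def scalar_prod_def atLeast0LessThan)
  also have "\<dots> = (\<Sum>l<4 * n. (if l = i then M $$ (l, j) else 0)
      + (if l = i + n then [:0, 1:] * M $$ (l, j) else 0))"
    using n by (intro sum.cong) auto
  also have "\<dots> = M $$ (i, j) + [:0, 1:] * M $$ (i + n, j)"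
    using i by (simp add: sum.distrib)
  finally show ?thesis .
qed

lemma shift_mat_right_inverse:
  assumes "n > 0"
  shows "shift_mat n * shift_right_inverse n = (1\<^sub>m (3 * n) :: 'a::field poly mat)"
proof (rule eq_matI)
  fix i j assume "i < dim_row (1\<^sub>m (3 * n) :: 'a poly mat)" "j < dim_col (1\<^sub>m (3 * n) :: 'a poly mat)"
  then have ij: "i < 3 * n" "j < 3 * n" by auto
  show "(shift_mat n * shift_right_inverse n) $$ (i, j) = (1\<^sub>m (3 * n) :: 'a poly mat) $$ (i, j)"
    unfolding shift_mat_mult[OF assms shift_right_inverse_carrier ij]
    using ij assms by (auto simp: shift_right_inverse_def power2_eq_square one_pCons)
qed (auto simp: shift_mat_def shift_right_inverse_def)

lemma shift_mat_transpose_mult_vec: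
  fixes u :: "'a::field poly vec"
  assumes n: "n > 0" and u: "u \<in> carrier_vec (3 * n)" and j: "j < 4 * n"
  shows "(transpose_mat (shift_mat n) *\<^sub>v u) $ j =
    (if j < 3 * n then u $ j else 0) + (if n \<le> j then [:0, 1:] * u $ (j - n) else 0)"
proof -
  have "(transpose_mat (shift_mat n) *\<^sub>v u) $ j =
      (\<Sum>l<3 * n. ((if j = l then 1 else 0) + (if j = l + n then [:0, 1:] else 0)) * u $ l)"
    using assms by (simp add: shift_mat_def scalar_prod_def atLeast0LessThan)
  \<comment> \<open>The guard \<open>n \<le> j\<close> is essential: for \<open>j < n\<close> the
    truncated difference \<open>j - n\<close> is 0 and would wrongly match
    \<open>l = 0\<close>.\<close>
  also have "\<dots> = (\<Sum>l<3 * n. (if l = j then u $ l else 0)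
      + (if l = j - n then if n \<le> j then [:0, 1:] * u $ l else 0 else 0))"
    using n by (intro sum.cong) auto
  also have "\<dots> = (if j < 3 * n then u $ j else 0) + (if n \<le> j then [:0, 1:] * u $ (j - n) else 0)"
    using j by (simp add: sum.distrib) auto
  finally show ?thesis .
qed

lemma shift_control_transpose_mult_vec:
  fixes y :: "'a::field poly vec"
  assumes n: "n > 0" and y: "y \<in> carrier_vec (4 * n)" and j: "j < n"
  shows "(transpose_mat (shift_control n) *\<^sub>v y) $ j =
    y $ (j + 3 * n) - [:0, 1:] * y $ (j + 2 * n) + [:0, 1:]\<^sup>2 * y $ (j + n) - [:0, 1:] ^ 3 * y $ j"
proof -
  have "(transpose_mat (shift_control n) *\<^sub>v y) $ j =
      (\<Sum>l<4 * n. ((if l = j + 3 * n then 1 else 0) - (if l = j + 2 * n then [:0, 1:] else 0)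
        + (if l = j + n then [:0, 1:]\<^sup>2 else 0) - (if l = j then [:0, 1:] ^ 3 else 0)) * y $ l)"
    using assms by (simp add: shift_control_def scalar_prod_def atLeast0LessThan)
  also have "\<dots> =
      (\<Sum>l<4 * n. (if l = j + 3 * n then y $ l else 0) - (if l = j + 2 * n then [:0, 1:] * y $ l else 0)
        + (if l = j + n then [:0, 1:]\<^sup>2 * y $ l else 0) - (if l = j then [:0, 1:] ^ 3 * y $ l else 0))"
    using n by (intro sum.cong) auto
  also have "\<dots> = y $ (j + 3 * n) - [:0, 1:] * y $ (j + 2 * n) + [:0, 1:]\<^sup>2 * y $ (j + n)
      - [:0, 1:] ^ 3 * y $ j"
    using j by (simp add: sum.distrib sum_subtractf)
  finally show ?thesis .
qed

text \<open>The equation \<open>u S = y\<close> is solved block by block from the left; the last block of \<open>y\<close> then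
  imposes exactly the condition expressed by \<open>shift_control\<close>.\<close>

lemma generated_code_shift_mat:
  assumes n: "n > 0"
  shows "generated_code (shift_mat n :: 'a::field poly mat) =
    {y \<in> carrier_vec (4 * n). transpose_mat (shift_control n) *\<^sub>v y = 0\<^sub>v n}" (is "?L = ?R")
proof (intro equalityI subsetI)
  fix y :: "'a poly vec" assume "y \<in> ?L"
  then obtain u where u: "u \<in> carrier_vec (3 * n)" and y: "y = transpose_mat (shift_mat n) *\<^sub>v u"
    by (auto simp: generated_code_def shift_mat_def)
  have yc: "y \<in> carrier_vec (4 * n)" unfolding y using u
    by (auto intro!: mult_mat_vec_carrier[of _ _ "3 * n"])
  \<comment> \<open>Each block of \<open>u\<close> enters two consecutive blocks of
    \<open>y\<close>, and its two contributions cancel in the alternating sum.\<close>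
  have "(transpose_mat (shift_control n) *\<^sub>v y) $ j = 0" if j: "j < n" for j
    unfolding shift_control_transpose_mult_vec[OF n yc j]
    using j u by (simp add: y shift_mat_transpose_mult_vec[OF n] power2_eq_square power3_eq_cube algebra_simps)
  then have "transpose_mat (shift_control n) *\<^sub>v y = 0\<^sub>v n"
    by (intro eq_vecI) (auto simp: shift_control_def)
  with yc show "y \<in> ?R" by simp
next
  fix y :: "'a poly vec" assume "y \<in> ?R"
  then have y: "y \<in> carrier_vec (4 * n)" and y0: "transpose_mat (shift_control n) *\<^sub>v y = 0\<^sub>v n"
    by auto
  \<comment> \<open>The control equation in Horner form; the bracket is the third block of the
    solution \<open>u\<close> defined below.\<close>
  have last: "y $ (j + 3 * n) = [:0, 1:] * (y $ (j + 2 * n) - [:0, 1:] * (y $ (j + n) - [:0, 1:] * y $ j))"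
    if j: "j < n" for j
  proof -
    have "y $ (j + 3 * n) - [:0, 1:] * y $ (j + 2 * n) + [:0, 1:]\<^sup>2 * y $ (j + n)
        - [:0, 1:] ^ 3 * y $ j = 0"
      using shift_control_transpose_mult_vec[OF n y j] j y0 by simp
    moreover have "a = z * (b - z * (c - z * d))" if "a - z * b + z\<^sup>2 * c - z ^ 3 * d = 0"
      for a b c d z :: "'a poly"
      using that by (simp add: power2_eq_square power3_eq_cube algebra_simps)
    ultimately show ?thesis by blast
  qed
  \<comment> \<open>Forward substitution: each block of \<open>u\<close> is the block of
    \<open>y\<close> minus \<open>z\<close> times the previous block of \<open>u\<close>.\<close>
  define u where "u = vec (3 * n) (\<lambda>i. if i < n then y $ i
    else if i < 2 * n then y $ i - [:0, 1:] * y $ (i - n)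
    else y $ i - [:0, 1:] * (y $ (i - n) - [:0, 1:] * y $ (i - 2 * n)))"
  have u: "u \<in> carrier_vec (3 * n)" by (simp add: u_def)
  have "(transpose_mat (shift_mat n) *\<^sub>v u) $ j = y $ j" if j: "j < 4 * n" for j
  proof (cases "j < 3 * n")
    case True
    then show ?thesis unfolding shift_mat_transpose_mult_vec[OF n u j]
      by (auto simp: u_def mult_2 diff_diff_left)
  next
    case False
    define i where "i = j - 3 * n"
    have i: "i < n" "j = i + 3 * n" using False j by (auto simp: i_def)
    have *: "i + 3 * n - n = i + 2 * n" "i + 2 * n - n = i + n" "i + 2 * n - 2 * n = i" by auto
    show ?thesis using i(1)
      unfolding shift_mat_transpose_mult_vec[OF n u j] unfolding i(2) last[OF i(1)] *
      by (simp add: u_def *)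
  qed
  then have "y = transpose_mat (shift_mat n) *\<^sub>v u"
    using y by (intro eq_vecI) (auto simp: shift_mat_def)
  then show "y \<in> ?L" using u by (auto simp: generated_code_def shift_mat_def)
qed

section \<open>Transport along an orthogonal matrix, and row degrees\<close>

text \<open>Since \<open>P\<close> and its transpose are mutually inverse, \<open>u S P = v\<close>
  is equivalent to \<open>u S = v P^T\<close>, and the row vector \<open>v P^T\<close> is written
  \<open>P *\<^sub>v v\<close>.\<close>

lemma mem_generated_code_mult_orthogonal:
  fixes P S :: "'a::field poly mat"
  assumes S: "S \<in> carrier_mat k N" and P: "P \<in> carrier_mat N N"
    and PT: "P * transpose_mat P = 1\<^sub>m N" and TP: "transpose_mat P * P = 1\<^sub>m N"
  shows "v \<in> generated_code (S * P) \<longleftrightarrow> v \<in> carrier_vec N \<and> P *\<^sub>v v \<in> generated_code S"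
proof -
  have T: "transpose_mat (S * P) *\<^sub>v u = transpose_mat P *\<^sub>v (transpose_mat S *\<^sub>v u)"
    if "u \<in> carrier_vec k" for u
    using that transpose_mult[OF S P] assoc_mult_mat_vec[of "transpose_mat P" N N "transpose_mat S" k u] S P
    by simp
  have inv1: "P *\<^sub>v (transpose_mat P *\<^sub>v w) = w" if "w \<in> carrier_vec N" for w
    using assoc_mult_mat_vec[of P N N "transpose_mat P" N w] that P PT by simp
  have inv2: "transpose_mat P *\<^sub>v (P *\<^sub>v w) = w" if "w \<in> carrier_vec N" for w
    using assoc_mult_mat_vec[of "transpose_mat P" N N P N w] that P TP by simp
  have c: "transpose_mat S *\<^sub>v u \<in> carrier_vec N" if "u \<in> carrier_vec k" for u
    using S that by (auto intro: mult_mat_vec_carrier)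
  have "v \<in> carrier_vec N \<and> P *\<^sub>v v \<in> generated_code S" if "v \<in> generated_code (S * P)"
    using that S P T inv1 c by (fastforce simp: generated_code_def)
  moreover have "v \<in> generated_code (S * P)" if "v \<in> carrier_vec N" "P *\<^sub>v v \<in> generated_code S"
    using that S P T inv2 by (force simp: generated_code_def)
  ultimately show ?thesis by blast
qed

lemma row_degree_eq_1:
  assumes M: "M \<in> carrier_mat k N" and i: "i < k" and j: "j < N" and "b j \<noteq> 0"
    and entry: "\<And>j. j < N \<Longrightarrow> M $$ (i, j) = [:a j, b j:]"
  shows "row_degree M i = 1"
proof -
  have "degree (M $$ (i, j)) = 1" using entry[OF j] \<open>b j \<noteq> 0\<close> by simp
  moreover have "degree (M $$ (i, l)) \<le> 1" if "l < N" for l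
    using entry[OF that] by simp
  ultimately show ?thesis
    unfolding row_degree_def using M j by (intro Max_eqI) (auto, metis)
qed

text \<open>If \<open>z y\<^sub>i + y\<^sub>i\<^sub>+\<^sub>n = 0\<close> throughout, the four terms of the control equation for \<open>y\<close> coincide, and
  their sum is \<open>-4 z\<^sup>3 y\<^sub>j\<close>.\<close>

lemma geometric_mem_generated_code_shift_mat:
  fixes y :: "'a::field poly vec"
  assumes n: "n > 0" and four: "(4 :: 'a poly) = 0" and y: "y \<in> carrier_vec (4 * n)"
    and rec: "\<And>i. i < 3 * n \<Longrightarrow> [:0, 1:] * y $ i + y $ (i + n) = 0"
  shows "y \<in> generated_code (shift_mat n)"
proof -
  have "(transpose_mat (shift_control n) *\<^sub>v y) $ j = 0" if j: "j < n" for j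
  proof -
    let ?z = "[:0, 1:] :: 'a poly"
    have s: "y $ (i + n) = - (?z * y $ i)" if "i < 3 * n" for i
      using rec[OF that] by (metis add.commute eq_neg_iff_add_eq_0)
    have 1: "y $ (j + n) = - (?z * y $ j)" using s[of j] j by simp
    have 2: "y $ (j + 2 * n) = ?z\<^sup>2 * y $ j"
      using s[of "j + n"] j 1 by (simp add: power2_eq_square mult_2 add.assoc)
    have 3: "y $ (j + 3 * n) = - (?z ^ 3 * y $ j)"
      using s[of "j + 2 * n"] j 2 by (simp add: power2_eq_square power3_eq_cube add.assoc)
    have sum: "- (z ^ 3 * a) - z * (z\<^sup>2 * a) + z\<^sup>2 * - (z * a) - z ^ 3 * a = - (4 * (z ^ 3 * a))"
      for z a :: "'a poly" by (simp add: power2_eq_square power3_eq_cube)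
    have "(transpose_mat (shift_control n) *\<^sub>v y) $ j =
        - (?z ^ 3 * y $ j) - ?z * (?z\<^sup>2 * y $ j) + ?z\<^sup>2 * - (?z * y $ j) - ?z ^ 3 * y $ j"
      unfolding shift_control_transpose_mult_vec[OF n y j] 1 2 3 ..
    also have "\<dots> = - (4 * (?z ^ 3 * y $ j))"
      by (rule sum)
    finally show ?thesis unfolding four by simp
  qed
  then have "transpose_mat (shift_control n) *\<^sub>v y = 0\<^sub>v n"
    by (intro eq_vecI) (auto simp: shift_control_def)
  then show ?thesis using y by (simp add: generated_code_shift_mat[OF n])
qed

section \<open>Control matrices and the reciprocal code\<close>

text \<open>The rows of \<open>G\<close> are codewords, obtained from unit vectors, so every control
  matrix annihilates them.\<close>

lemma generated_code_mult_control_matrix: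
  fixes G H :: "'a::field poly mat"
  assumes G: "G \<in> carrier_mat k N" and "control_matrix N m (generated_code G) H"
  shows "G * H = 0\<^sub>m k (N - m)"
proof (rule eq_matI)
  have H: "H \<in> carrier_mat N (N - m)"
    and C: "generated_code G = {v \<in> carrier_vec N. transpose_mat H *\<^sub>v v = 0\<^sub>v (N - m)}"
    using assms(2) by (auto simp: control_matrix_def)
  fix i j assume "i < dim_row (0\<^sub>m k (N - m) :: 'a poly mat)" "j < dim_col (0\<^sub>m k (N - m) :: 'a poly mat)"
  then have ij: "i < k" "j < N - m" by auto
  have "transpose_mat G *\<^sub>v unit_vec k i = row G i"
    using G ij by (simp add: mult_mat_vec_unit_vec[of _ N k])
  then have "row G i \<in> generated_code G"
    unfolding generated_code_def using G by (auto intro!: exI[of _ "unit_vec k i"])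
  then have "(transpose_mat H *\<^sub>v row G i) $ j = 0" using C ij by auto
  then show "(G * H) $$ (i, j) = 0\<^sub>m k (N - m) $$ (i, j)"
    using G H ij by (simp add: comm_scalar_prod[of _ N])
qed (use assms in \<open>auto simp: control_matrix_def\<close>)

text \<open>The relation \<open>S (P H) = 0\<close> links rows \<open>i\<close> and
  \<open>i + n\<close> of \<open>P H\<close>. Inverting \<open>z\<close> turns it into the
  recurrence of \<open>geometric_mem_generated_code_shift_mat\<close>, which passes to linear
  combinations of columns.\<close>

lemma reciprocal_code_subset:
  fixes U :: "'a::field mat" and n :: nat
  defines "P \<equiv> map_mat (\<lambda>a. [:a:]) U"
  assumes n: "n > 0" and four: "(4 :: 'a poly) = 0"
    and U: "U \<in> carrier_mat (4 * n) (4 * n)"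
    and PT: "P * transpose_mat P = 1\<^sub>m (4 * n)" and TP: "transpose_mat P * P = 1\<^sub>m (4 * n)"
    and H: "control_matrix (4 * n) (3 * n) (generated_code (shift_mat n * P)) H"
    and R: "reciprocal_transpose H R"
  shows "generated_code R \<subseteq> generated_code (shift_mat n * P)"
proof
  have P: "P \<in> carrier_mat (4 * n) (4 * n)" using U by (simp add: P_def)
  have Hc: "H \<in> carrier_mat (4 * n) n" using H by (simp add: control_matrix_def)
  have "(shift_mat n * P) * H = 0\<^sub>m (3 * n) n"
    using generated_code_mult_control_matrix[OF _ H] P by (simp add: mult_carrier_mat[of _ _ "4 * n"])
  then have SPH: "shift_mat n * (P * H) = 0\<^sub>m (3 * n) n"
    by (simp add: assoc_mult_mat[OF shift_mat_carrier P Hc])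
  obtain e :: int where e: "map_mat to_fract R = (fract_z powi e) \<cdot>\<^sub>m transpose_mat (map_mat subst_inverse H)"
    using R by (auto simp: reciprocal_transpose_def)
  then have Rc: "R \<in> carrier_mat n (4 * n)"
    using Hc by (metis carrier_matD carrier_matI index_map_mat(2,3) index_smult_mat(2,3) index_transpose_mat(2,3))
  have Rent: "to_fract (R $$ (j, l)) = fract_z powi e * subst_inverse (H $$ (l, j))"
    if "j < n" "l < 4 * n" for j l
    using arg_cong[OF e, of "\<lambda>M. M $$ (j, l)"] that Rc Hc by simp
  \<comment> \<open>The columns of \<open>M\<close> are the images under \<open>P\<close> of the
    generators of the reciprocal code. As \<open>P\<close> is constant, \<open>M\<close> is
    \<open>P * H\<close> at the inverse of \<open>z\<close>, up to the power
    \<open>e\<close>.\<close>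
  define M where "M = P * transpose_mat R"
  have Mc: "M \<in> carrier_mat (4 * n) n" using P Rc by (simp add: M_def mult_carrier_mat[of _ _ "4 * n"])
  have Mfract: "to_fract (M $$ (i, j)) = fract_z powi e * subst_inverse ((P * H) $$ (i, j))"
    if "i < 4 * n" "j < n" for i j
  proof -
    have "M $$ (i, j) = (\<Sum>l<4 * n. [:U $$ (i, l):] * R $$ (j, l))"
      using that U Rc by (simp add: M_def P_def scalar_prod_def atLeast0LessThan)
    moreover have "(P * H) $$ (i, j) = (\<Sum>l<4 * n. [:U $$ (i, l):] * H $$ (l, j))"
      using that U Hc by (simp add: P_def scalar_prod_def atLeast0LessThan)
    ultimately show ?thesis using that
      by (simp only: to_fract_sum to_fract_mult subst_inverse_sum subst_inverse_const_mult sum_distrib_left)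
         (auto simp: Rent intro!: sum.cong)
  qed
  have Mrec: "[:0, 1:] * M $$ (i, j) + M $$ (i + n, j) = 0" if i: "i < 3 * n" and j: "j < n" for i j
  proof -
    let ?x = "subst_inverse ((P * H) $$ (i, j))" and ?x' = "subst_inverse ((P * H) $$ (i + n, j))"
    have "(P * H) $$ (i, j) + [:0, 1:] * (P * H) $$ (i + n, j) = 0"
      using shift_mat_mult[OF n mult_carrier_mat[OF P Hc] i j] SPH i j by simp
    from arg_cong[OF this, of subst_inverse] have "?x + inverse fract_z * ?x' = 0"
      by (simp add: subst_inverse_add)
    \<comment> \<open>Clearing the denominator moves the factor \<open>z\<close> from the later
      block to the earlier one.\<close>
    then have "fract_z * ?x + ?x' = 0"
      by (simp add: field_simps fract_z_def)
    then have "fract_z powi e * (fract_z * ?x + ?x') = 0" by simp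
    then have "fract_z * (fract_z powi e * ?x) + fract_z powi e * ?x' = 0"
      by (simp add: algebra_simps)
    \<comment> \<open>With the power \<open>e\<close> absorbed, both entries are polynomials again,
      and injectivity of \<open>to_fract\<close> gives a polynomial identity.\<close>
    then have "to_fract ([:0, 1:] * M $$ (i, j) + M $$ (i + n, j)) = 0"
      using i j by (simp only: to_fract_add to_fract_mult) (simp add: Mfract flip: fract_z_def)
    then show ?thesis by (simp only: to_fract_eq_0_iff)
  qed
  fix v assume "v \<in> generated_code R"
  then obtain u where u: "u \<in> carrier_vec n" and v: "v = transpose_mat R *\<^sub>v u"
    using Rc by (auto simp: generated_code_def)
  have Pv: "P *\<^sub>v v = M *\<^sub>v u"
    unfolding v M_def using P Rc u by (simp add: assoc_mult_mat_vec[of _ _ "4 * n" _ n])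
  have "M *\<^sub>v u \<in> generated_code (shift_mat n)"
  proof (rule geometric_mem_generated_code_shift_mat[OF n four])
    show "M *\<^sub>v u \<in> carrier_vec (4 * n)" using Mc u by simp
    fix i assume i: "i < 3 * n"
    have "[:0, 1:] * (M *\<^sub>v u) $ i + (M *\<^sub>v u) $ (i + n) =
        (\<Sum>j<n. ([:0, 1:] * M $$ (i, j) + M $$ (i + n, j)) * u $ j)"
      using i Mc u
      by (simp add: scalar_prod_def atLeast0LessThan sum_distrib_left sum.distrib distrib_right mult.assoc
            del: mult_pCons_left)
    then show "[:0, 1:] * (M *\<^sub>v u) $ i + (M *\<^sub>v u) $ (i + n) = 0"
      using Mrec[OF i] by simp
  qed
  moreover have "v \<in> carrier_vec (4 * n)" using v Rc u by simp
  ultimately show "v \<in> generated_code (shift_mat n * P)"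
    unfolding mem_generated_code_mult_orthogonal[OF shift_mat_carrier P PT TP] Pv by simp
qed

text \<open>Supplies the existence half of \<open>dual_containing\<close>: \<open>v\<close> times
  this matrix is \<open>v P^T\<close> times \<open>shift_control\<close>, which vanishes exactly
  when \<open>v P^T\<close> lies in the row module of \<open>S\<close>.\<close>

lemma control_matrix_shift_mat_mult_orthogonal:
  fixes P :: "'a::field poly mat"
  assumes n: "n > 0" and P: "P \<in> carrier_mat (4 * n) (4 * n)"
    and PT: "P * transpose_mat P = 1\<^sub>m (4 * n)" and TP: "transpose_mat P * P = 1\<^sub>m (4 * n)"
  shows "control_matrix (4 * n) (3 * n) (generated_code (shift_mat n * P))
    (transpose_mat P * shift_control n)"
proof -
  have "transpose_mat (transpose_mat P * shift_control n) *\<^sub>v v = transpose_mat (shift_control n) *\<^sub>v (P *\<^sub>v v)"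
    if "v \<in> carrier_vec (4 * n)" for v
    using that P transpose_mult[of "transpose_mat P" "4 * n" "4 * n" "shift_control n" n]
      assoc_mult_mat_vec[of "transpose_mat (shift_control n)" n "4 * n" P "4 * n" v]
    by simp
  then show ?thesis
    unfolding control_matrix_def
    using mem_generated_code_mult_orthogonal[OF shift_mat_carrier P PT TP] P
    by (auto simp: generated_code_shift_mat[OF n] mult_carrier_mat[of _ _ "4 * n"])
qed

section \<open>The block form of \<open>U\<close> and the conclusion\<close>

lemma append_rows_index:
  assumes "A \<in> carrier_mat p m" "B \<in> carrier_mat q m" "i < p + q" "j < m"
  shows "(A @\<^sub>r B) $$ (i, j) = (if i < p then A $$ (i, j) else B $$ (i - p, j))"
  using assms by (auto simp: append_rows_def)

lemma map_mat_const_poly_mult: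
  fixes U V :: "'a::comm_ring_1 mat"
  assumes U: "U \<in> carrier_mat k m" and V: "V \<in> carrier_mat m l"
  shows "map_mat (\<lambda>a. [:a:]) (U * V) = map_mat (\<lambda>a. [:a:]) U * map_mat (\<lambda>a. [:a:]) V"
proof -
  interpret semiring_hom "\<lambda>a :: 'a. [:a:]"
    by unfold_locales (auto simp: one_pCons)
  show ?thesis by (rule mat_hom_mult[OF U V])
qed

theorem mainTheorem2:
  fixes n :: nat and U A B C D :: "'a::field mat" and G :: "'a poly mat"
  assumes "CHAR('a) = 2"
    and "n > 0"
    and "A \<in> carrier_mat n (4 * n)" "B \<in> carrier_mat n (4 * n)"
        "C \<in> carrier_mat n (4 * n)" "D \<in> carrier_mat n (4 * n)"
    and "U = A @\<^sub>r B @\<^sub>r C @\<^sub>r D"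
    and "U * transpose_mat U = 1\<^sub>m (4 * n)"
    and "G = map_mat (\<lambda>a. [:a:]) (A @\<^sub>r B @\<^sub>r C)
             + [:0, 1:] \<cdot>\<^sub>m map_mat (\<lambda>a. [:a:]) (B @\<^sub>r C @\<^sub>r D)"
  shows "generator_matrix (4 * n) (3 * n) (3 * n) 1 G
       \<and> noncatastrophic G
       \<and> convolutional_code (4 * n) (3 * n) (3 * n) 1 (generated_code G)
       \<and> dual_containing (4 * n) (3 * n) (generated_code G)"
proof -
  note n = assms(2) and carr = assms(3-6)
  define P where "P = map_mat (\<lambda>a. [:a:]) U"
  have carr2: "C @\<^sub>r D \<in> carrier_mat (2 * n) (4 * n)" "B @\<^sub>r C \<in> carrier_mat (2 * n) (4 * n)"
    using carrier_append_rows[OF carr(3,4)] carrier_append_rows[OF carr(2,3)] by (simp_all add: mult_2)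
  have carr3: "B @\<^sub>r C @\<^sub>r D \<in> carrier_mat (3 * n) (4 * n)" "A @\<^sub>r B @\<^sub>r C \<in> carrier_mat (3 * n) (4 * n)"
    using carrier_append_rows[OF carr(2) carr2(1)] carrier_append_rows[OF carr(1) carr2(2)] by simp_all
  have U: "U \<in> carrier_mat (4 * n) (4 * n)"
    using carrier_append_rows[OF carr(1) carr3(1)] assms(7) by simp
  \<comment> \<open>For square matrices over a field a one-sided inverse is two-sided.\<close>
  have UT: "transpose_mat U * U = 1\<^sub>m (4 * n)"
    using mat_mult_left_right_inverse[OF U _ assms(8)] U by simp
  have P: "P \<in> carrier_mat (4 * n) (4 * n)" using U by (simp add: P_def)
  have T: "transpose_mat P = map_mat (\<lambda>a. [:a:]) (transpose_mat U)"
    by (simp add: P_def map_mat_transpose)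
  have one: "map_mat (\<lambda>a. [:a:]) (1\<^sub>m (4 * n)) = (1\<^sub>m (4 * n) :: 'a poly mat)"
    by (auto intro!: eq_matI simp: one_pCons)
  have PT: "P * transpose_mat P = 1\<^sub>m (4 * n)" and TP: "transpose_mat P * P = 1\<^sub>m (4 * n)"
    unfolding T using U
    by (simp_all add: P_def one assms(8) UT flip: map_mat_const_poly_mult[of _ "4 * n" "4 * n" _ "4 * n"])

  \<comment> \<open>The two coefficient matrices of \<open>G\<close> are windows of
    \<open>3 * n\<close> rows of \<open>U\<close>, starting at rows 0 and \<open>n\<close>; this
    gives \<open>G = S P\<close>.\<close>
  have U_top: "(A @\<^sub>r B @\<^sub>r C) $$ (i, j) = U $$ (i, j)" if "i < 3 * n" "j < 4 * n" for i j
    using that carr carr2 carr3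
    by (auto simp: assms(7) append_rows_index[of _ n _ _ n] append_rows_index[of _ n _ _ "2 * n"]
        append_rows_index[of _ n _ _ "3 * n"])
  have U_bottom: "(B @\<^sub>r C @\<^sub>r D) $$ (i, j) = U $$ (i + n, j)" if "i < 3 * n" "j < 4 * n" for i j
    using that carr3 carr by (simp add: assms(7) append_rows_index[of _ n _ _ "3 * n"])
  have entry: "G $$ (i, j) = [:U $$ (i, j), U $$ (i + n, j):]" if "i < 3 * n" "j < 4 * n" for i j
    using that carr3 unfolding assms(9) by (simp add: U_top U_bottom)
  have G: "G \<in> carrier_mat (3 * n) (4 * n)" using carr3 unfolding assms(9) by simp
  have G_eq: "G = shift_mat n * P"
  proof (rule eq_matI)
    fix i j assume "i < dim_row (shift_mat n * P)" "j < dim_col (shift_mat n * P)"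
    then have ij: "i < 3 * n" "j < 4 * n" using P by (auto simp: shift_mat_def)
    show "G $$ (i, j) = (shift_mat n * P) $$ (i, j)"
      unfolding shift_mat_mult[OF n P ij] entry[OF ij] using ij U by (simp add: P_def)
  qed (use G P in \<open>auto simp: shift_mat_def\<close>)

  \<comment> \<open>In \<open>G * K\<close> the middle factor \<open>P * transpose_mat P\<close>
    cancels, leaving \<open>S\<close> times its right inverse.\<close>
  define K where "K = transpose_mat P * shift_right_inverse n"
  have K: "K \<in> carrier_mat (4 * n) (3 * n)"
    using P by (simp add: K_def mult_carrier_mat[of _ _ "4 * n"])
  have "G * K = shift_mat n * ((P * transpose_mat P) * shift_right_inverse n)"
    unfolding G_eq K_def using P
    by (simp add: assoc_mult_mat[of _ "3 * n" "4 * n" _ "4 * n" _ "3 * n"]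
        assoc_mult_mat[of _ "4 * n" "4 * n" _ "4 * n" _ "3 * n"] mult_carrier_mat[of _ _ "4 * n"])
  also have "\<dots> = 1\<^sub>m (3 * n)"
    unfolding PT left_mult_one_mat[OF shift_right_inverse_carrier] by (rule shift_mat_right_inverse[OF n])
  finally have GK: "G * K = 1\<^sub>m (3 * n)" .
  note ranks = poly_rank_of_one_sided_inverse[OF G K GK]

  have deg: "row_degree G i = 1" if i: "i < 3 * n" for i
  proof -
    \<comment> \<open>Row \<open>i + n\<close> of \<open>U\<close> holds the coefficients of
      \<open>z\<close> in row \<open>i\<close> of \<open>G\<close>. It is nonzero because its scalar
      product with itself is 1.\<close>
    have "\<exists>j<4 * n. U $$ (i + n, j) \<noteq> 0"
    proof (rule ccontr)
      assume "\<not> ?thesis"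
      then have "(U * transpose_mat U) $$ (i + n, i + n) = 0"
        using U i by (simp add: scalar_prod_def)
      then show False using i by (simp add: assms(8))
    qed
    then show ?thesis
      using row_degree_eq_1[OF G i _ _ entry[OF i]] by blast
  qed
  have "row_degree G ` {..<3 * n} = {1}" using deg n by (auto simp: image_iff intro!: exI[of _ 0])
  then have gen: "generator_matrix (4 * n) (3 * n) (3 * n) 1 G"
    using G ranks deg by (simp add: generator_matrix_def)

  \<comment> \<open>Characteristic 2 enters here, to make the sum of four equal terms
    vanish.\<close>
  have "of_nat 2 = (0 :: 'a)" using of_nat_CHAR[where ?'a = 'a] assms(1) by metis
  then have "(2 :: 'a) = 0" by simp
  then have "(4 :: 'a) = 0" by (metis mult_zero_left num_double numeral_times_numeral)
  then have four: "(4 :: 'a poly) = 0" by (simp add: numeral_poly)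
  have "dual_containing (4 * n) (3 * n) (generated_code G)"
    unfolding dual_containing_def
    using control_matrix_shift_mat_mult_orthogonal[OF n P PT TP]
      reciprocal_code_subset[OF n four U PT[unfolded P_def] TP[unfolded P_def]]
    unfolding G_eq P_def by blast
  then show ?thesis
    using gen G K GK ranks by (auto simp: noncatastrophic_def convolutional_code_def)
qed

end
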